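(* Let $A\subseteq\mathrm{Ag}$, let $x\in\{D,T,B,4,5\}$, and let $\mathsf{L}_1,\mathsf{L}_2$ be logics without fixed-point operators such that $\mathsf{L}_1(\alpha)=\mathsf{L}_2(\alpha)\cup\{x\}$ for $\alpha\in A$ and $\mathsf{L}_1(\alpha)=\mathsf{L}_2(\alpha)$ otherwise. Assume that, for each agent $\alpha$, $\mathsf{L}_2(\alpha)$ only includes frame conditions that precede $x$ in the order $D,T,B,4,5$. Then for every formula $\varphi$ (without fixed-point operators), $\varphi$ is $\mathsf{L}_1$-satisfiable if and only if $\mathrm{tr}^x_A(\varphi)$ is $\mathsf{L}_2$-satisfiable, where $$\mathrm{tr}^x_A(\varphi)=\varphi\wedge\mathsf{Inv}_d\Big(\bigwedge_{\psi\in\overline{\mathsf{sub}}(\varphi),\ \alpha\in A}\mathsf{ax}^x_\alpha[\psi/p]\Big),$$ with $d=md(\varphi)$ if $x\notin\{4,5\}$ and $d=md(\varphi)\cdot|\varphi|$ if $x\in\{4,5\}$.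
   Context: Fix a finite set $\mathrm{Ag}$ of agents and finitely many propositional variables. Formulas (without fixed points): $\varphi ::= p \mid \neg p \mid \mathtt{tt} \mid \mathtt{ff} \mid \varphi\wedge\varphi \mid \varphi\vee\varphi \mid \langle\alpha\rangle\varphi \mid [\alpha]\varphi$, interpreted on Kripke models $(W,R,V)$ with $R\subseteq W\times\mathrm{Ag}\times W$ (agent relations $R_\alpha$) in the standard way. Negation $\neg\psi$ of an arbitrary formula is defined by pushing negation inwards via De Morgan and modal dualities, and $\psi\to\chi$ abbreviates $\neg\psi\vee\chi$. Frame conditions on $R_\alpha$: $D$ serial, $T$ reflexive, $B$ symmetric, $4$ transitive, $5$ euclidean. A logic $\mathsf{L}$ assigns to each agent $\alpha$ a set $\mathsf{L}(\alpha)$ of conditions; $\mathsf{L}$-models are Kripke models where each $R_\alpha$ satisfies $\mathsf{L}(\alpha)$; $\varphi$ is $\mathsf{L}$-satisfiable if true at some state of some $\mathsf{L}$-model. $\mathsf{sub}(\varphi)$ is the set of subformulas of $\varphi$, $|\varphi|=|\mathsf{sub}(\varphi)|$, and $\overline{\mathsf{sub}}(\varphi)=\mathsf{sub}(\varphi)\cup\{\neg\psi\mid\psi\in\mathsf{sub}(\varphi)\}$. Modal depth: $md$ is $0$ on $p,\neg p,\mathtt{tt},\mathtt{ff}$, $md(\psi\wedge\chi)=md(\psi\vee\chi)=\max(md(\psi),md(\chi))$, $md([\alpha]\psi)=md(\langle\alpha\rangle\psi)=1+md(\psi)$. $[\mathrm{Ag}]\chi=\bigwedge_{\alpha\in\mathrm{Ag}}[\alpha]\chi$,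 $[\mathrm{Ag}]^0\chi=\chi$, $[\mathrm{Ag}]^{i+1}\chi=[\mathrm{Ag}][\mathrm{Ag}]^i\chi$, and $\mathsf{Inv}_d(\chi)=\bigwedge_{i\le d}[\mathrm{Ag}]^i\chi$. Axioms (with $p$ a placeholder variable, $[\psi/p]$ substitution): $\mathsf{ax}^D_\alpha=\langle\alpha\rangle\mathtt{tt}$; $\mathsf{ax}^T_\alpha=[\alpha]p\to p$; $\mathsf{ax}^B_\alpha=\langle\alpha\rangle[\alpha]p\to p$; $\mathsf{ax}^4_\alpha=[\alpha]p\to[\alpha][\alpha]p$; $\mathsf{ax}^5_\alpha=\langle\alpha\rangle[\alpha]p\to[\alpha]p$. *)

theory Defs
  imports "HOL-Library.Infinite_Typeclass"
begin

datatype ('ag, 'p) fm =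
    Prop 'p
  | NProp 'p
  | TT
  | FF
  | And "('ag, 'p) fm" "('ag, 'p) fm"
  | Or "('ag, 'p) fm" "('ag, 'p) fm"
  | Dia 'ag "('ag, 'p) fm"
  | Box 'ag "('ag, 'p) fm"

primrec neg :: "('ag, 'p) fm \<Rightarrow> ('ag, 'p) fm" where
  "neg (Prop p) = NProp p"
| "neg (NProp p) = Prop p"
| "neg TT = FF"
| "neg FF = TT"
| "neg (And \<phi> \<psi>) = Or (neg \<phi>) (neg \<psi>)"
| "neg (Or \<phi> \<psi>) = And (neg \<phi>) (neg \<psi>)"
| "neg (Dia \<alpha> \<phi>) = Box \<alpha> (neg \<phi>)"
| "neg (Box \<alpha> \<phi>) = Dia \<alpha> (neg \<phi>)"

definition Imp :: "('ag, 'p) fm \<Rightarrow> ('ag, 'p) fm \<Rightarrow> ('ag, 'p) fm" where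
  "Imp \<phi> \<psi> = Or (neg \<phi>) \<psi>"

text \<open>A negated variable is a literal of the grammar, so its only subformula is itself.\<close>

primrec sub :: "('ag, 'p) fm \<Rightarrow> ('ag, 'p) fm set" where
  "sub (Prop p) = {Prop p}"
| "sub (NProp p) = {NProp p}"
| "sub TT = {TT}"
| "sub FF = {FF}"
| "sub (And \<phi> \<psi>) = insert (And \<phi> \<psi>) (sub \<phi> \<union> sub \<psi>)"
| "sub (Or \<phi> \<psi>) = insert (Or \<phi> \<psi>) (sub \<phi> \<union> sub \<psi>)"
| "sub (Dia \<alpha> \<phi>) = insert (Dia \<alpha> \<phi>) (sub \<phi>)"
| "sub (Box \<alpha> \<phi>) = insert (Box \<alpha> \<phi>) (sub \<phi>)"

definition sub_bar :: "('ag, 'p) fm \<Rightarrow> ('ag, 'p) fm set" where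
  "sub_bar \<phi> = sub \<phi> \<union> neg ` sub \<phi>"

definition fm_size :: "('ag, 'p) fm \<Rightarrow> nat" where
  "fm_size \<phi> = card (sub \<phi>)"

primrec md :: "('ag, 'p) fm \<Rightarrow> nat" where
  "md (Prop p) = 0"
| "md (NProp p) = 0"
| "md TT = 0"
| "md FF = 0"
| "md (And \<phi> \<psi>) = max (md \<phi>) (md \<psi>)"
| "md (Or \<phi> \<psi>) = max (md \<phi>) (md \<psi>)"
| "md (Dia \<alpha> \<phi>) = 1 + md \<phi>"
| "md (Box \<alpha> \<phi>) = 1 + md \<phi>"

primrec subst :: "('q \<Rightarrow> ('ag, 'p) fm) \<Rightarrow> ('ag, 'q) fm \<Rightarrow> ('ag, 'p) fm" where
  "subst \<sigma> (Prop q) = \<sigma> q"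
| "subst \<sigma> (NProp q) = neg (\<sigma> q)"
| "subst \<sigma> TT = TT"
| "subst \<sigma> FF = FF"
| "subst \<sigma> (And \<phi> \<psi>) = And (subst \<sigma> \<phi>) (subst \<sigma> \<psi>)"
| "subst \<sigma> (Or \<phi> \<psi>) = Or (subst \<sigma> \<phi>) (subst \<sigma> \<psi>)"
| "subst \<sigma> (Dia \<alpha> \<phi>) = Dia \<alpha> (subst \<sigma> \<phi>)"
| "subst \<sigma> (Box \<alpha> \<phi>) = Box \<alpha> (subst \<sigma> \<phi>)"

text \<open>Conjunction over a finite set of formulas, in an arbitrary but fixed order without
  repetitions; the empty conjunction is \<^term>\<open>TT\<close>.\<close>

definition big_and :: "('ag, 'p) fm set \<Rightarrow> ('ag, 'p) fm" where
  "big_and S = foldr And (SOME xs. set xs = S \<and> distinct xs) TT"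

definition box_all :: "('ag::finite, 'p) fm \<Rightarrow> ('ag, 'p) fm" where
  "box_all \<chi> = big_and ((\<lambda>\<alpha>. Box \<alpha> \<chi>) ` UNIV)"

definition Inv :: "nat \<Rightarrow> ('ag::finite, 'p) fm \<Rightarrow> ('ag, 'p) fm" where
  "Inv d \<chi> = big_and ((\<lambda>i. (box_all ^^ i) \<chi>) ` {..d})"

record ('w, 'ag, 'p) kripke =
  worlds :: "'w set"
  rel :: "('w \<times> 'ag \<times> 'w) set"
  val :: "'p \<Rightarrow> 'w set"

definition kripke_model :: "('w, 'ag, 'p) kripke \<Rightarrow> bool" where
  "kripke_model M \<longleftrightarrow> worlds M \<noteq> {} \<and> rel M \<subseteq> worlds M \<times> UNIV \<times> worlds M
    \<and> (\<forall>p. val M p \<subseteq> worlds M)"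

definition acc :: "('w, 'ag, 'p) kripke \<Rightarrow> 'ag \<Rightarrow> ('w \<times> 'w) set" where
  "acc M \<alpha> = {(u, v). (u, \<alpha>, v) \<in> rel M}"

primrec sat :: "('w, 'ag, 'p) kripke \<Rightarrow> 'w \<Rightarrow> ('ag, 'p) fm \<Rightarrow> bool" where
  "sat M w (Prop p) \<longleftrightarrow> w \<in> val M p"
| "sat M w (NProp p) \<longleftrightarrow> w \<notin> val M p"
| "sat M w TT \<longleftrightarrow> True"
| "sat M w FF \<longleftrightarrow> False"
| "sat M w (And \<phi> \<psi>) \<longleftrightarrow> sat M w \<phi> \<and> sat M w \<psi>"
| "sat M w (Or \<phi> \<psi>) \<longleftrightarrow> sat M w \<phi> \<or> sat M w \<psi>"
| "sat M w (Dia \<alpha> \<phi>) \<longleftrightarrow> (\<exists>v. (w, v) \<in> acc M \<alpha> \<and> sat M v \<phi>)"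
| "sat M w (Box \<alpha> \<phi>) \<longleftrightarrow> (\<forall>v. (w, v) \<in> acc M \<alpha> \<longrightarrow> sat M v \<phi>)"

datatype cond = cD | cT | cB | c4 | c5

definition serial_on :: "'w set \<Rightarrow> ('w \<times> 'w) set \<Rightarrow> bool" where
  "serial_on W r \<longleftrightarrow> (\<forall>u\<in>W. \<exists>v\<in>W. (u, v) \<in> r)"

definition euclidean :: "('w \<times> 'w) set \<Rightarrow> bool" where
  "euclidean r \<longleftrightarrow> (\<forall>u v w. (u, v) \<in> r \<longrightarrow> (u, w) \<in> r \<longrightarrow> (v, w) \<in> r)"

primrec satisfies_cond :: "'w set \<Rightarrow> ('w \<times> 'w) set \<Rightarrow> cond \<Rightarrow> bool" where
  "satisfies_cond W r cD \<longleftrightarrow> serial_on W r"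
| "satisfies_cond W r cT \<longleftrightarrow> refl_on W r"
| "satisfies_cond W r cB \<longleftrightarrow> sym r"
| "satisfies_cond W r c4 \<longleftrightarrow> trans r"
| "satisfies_cond W r c5 \<longleftrightarrow> euclidean r"

primrec cond_rank :: "cond \<Rightarrow> nat" where
  "cond_rank cD = 0"
| "cond_rank cT = 1"
| "cond_rank cB = 2"
| "cond_rank c4 = 3"
| "cond_rank c5 = 4"

definition precedes :: "cond \<Rightarrow> cond \<Rightarrow> bool" where
  "precedes y x \<longleftrightarrow> cond_rank y < cond_rank x"

definition L_model :: "('ag \<Rightarrow> cond set) \<Rightarrow> ('w, 'ag, 'p) kripke \<Rightarrow> bool" where
  "L_model L M \<longleftrightarrow> kripke_model M
    \<and> (\<forall>\<alpha>. \<forall>y\<in>L \<alpha>. satisfies_cond (worlds M) (acc M \<alpha>) y)"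

text \<open>HOL cannot quantify over types inside a formula, so satisfiability carries the type from
  which the carriers of the models are drawn. The carrier is an arbitrary nonempty subset of it.\<close>

definition satisfiable :: "'w itself \<Rightarrow> ('ag \<Rightarrow> cond set) \<Rightarrow> ('ag, 'p) fm \<Rightarrow> bool" where
  "satisfiable (_ :: 'w itself) L \<phi> \<longleftrightarrow>
    (\<exists>M :: ('w, 'ag, 'p) kripke. L_model L M \<and> (\<exists>w\<in>worlds M. sat M w \<phi>))"

text \<open>The placeholder variable of the axiom schemes is the only variable of type \<^typ>\<open>unit\<close>.\<close>

abbreviation placeholder :: "('ag, unit) fm" where
  "placeholder \<equiv> Prop ()"

primrec ax :: "cond \<Rightarrow> 'ag \<Rightarrow> ('ag, unit) fm" where
  "ax cD \<alpha> = Dia \<alpha> TT"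
| "ax cT \<alpha> = Imp (Box \<alpha> placeholder) placeholder"
| "ax cB \<alpha> = Imp (Dia \<alpha> (Box \<alpha> placeholder)) placeholder"
| "ax c4 \<alpha> = Imp (Box \<alpha> placeholder) (Box \<alpha> (Box \<alpha> placeholder))"
| "ax c5 \<alpha> = Imp (Dia \<alpha> (Box \<alpha> placeholder)) (Box \<alpha> placeholder)"

definition ax_inst :: "cond \<Rightarrow> 'ag \<Rightarrow> ('ag, 'p) fm \<Rightarrow> ('ag, 'p) fm" where
  "ax_inst x \<alpha> \<psi> = subst (\<lambda>_. \<psi>) (ax x \<alpha>)"

definition tr_depth :: "cond \<Rightarrow> ('ag, 'p) fm \<Rightarrow> nat" where
  "tr_depth x \<phi> = (if x \<in> {c4, c5} then md \<phi> * fm_size \<phi> else md \<phi>)"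

definition tr :: "cond \<Rightarrow> 'ag set \<Rightarrow> ('ag::finite, 'p) fm \<Rightarrow> ('ag, 'p) fm" where
  "tr x A \<phi> = And \<phi>
    (Inv (tr_depth x \<phi>) (big_and {ax_inst x \<alpha> \<psi> | \<psi> \<alpha>. \<psi> \<in> sub_bar \<phi> \<and> \<alpha> \<in> A}))"

lemma neg_neg [simp]: "neg (neg \<phi>) = \<phi>"
  by (induction \<phi>) simp_all

lemma sat_neg [simp]: "sat M w (neg \<phi>) \<longleftrightarrow> \<not> sat M w \<phi>"
  by (induction \<phi> arbitrary: w) simp_all

lemma finite_sub [simp]: "finite (sub \<phi>)"
  by (induction \<phi>) simp_all

lemma sat_big_and:
  assumes "finite S"
  shows "sat M w (big_and S) \<longleftrightarrow> (\<forall>\<chi>\<in>S. sat M w \<chi>)"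
proof -
  have "sat M w (foldr And xs TT) \<longleftrightarrow> (\<forall>\<chi>\<in>set xs. sat M w \<chi>)" for xs
    by (induction xs) simp_all
  moreover have "set (SOME xs. set xs = S \<and> distinct xs) = S"
    using someI_ex[OF finite_distinct_list[OF assms]] by blast
  ultimately show ?thesis
    by (simp add: big_and_def)
qed

end

theory Submission
  imports Defs "HOL-Library.Countable_Set"
begin

text \<open>Frame conditions make the axioms valid, which is one direction. For the other, only this is
  used of the given model: every world within distance \<open>md \<phi> * c\<close> of the root satisfies the
  axioms of \<open>L1\<close> for all \<open>\<psi>\<close> in \<open>sub_bar \<phi>\<close>. A new model consists of the worlds near the root
  together with a rank, the modal depth up to which formulas still matter. Two nodes are related
  when the boxed formulas in \<open>sub_bar \<phi>\<close> that hold at their worlds fit together in the way the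
  frame conditions of the agent would enforce, so these conditions hold by construction; what has to
  be shown is that every diamond has a witness close enough to the root. Steps of an agent with
  condition 4 or 5 keep the rank, but along axiom 4 the set of true boxes can grow fewer than
  \<open>fm_size \<phi>\<close> times, and along axiom 5 it is constant after one step; when it is constant, a
  witness can be taken one step closer to the root. Thus each unit of rank costs at most
  \<open>c = fm_size \<phi>\<close> steps, or \<open>c = 1\<close> if neither 4 nor 5 occurs. A countable submodel
  closed under witnesses brings the result back to the infinite type of worlds.\<close>

section \<open>Axioms and invariants\<close>

definition near :: "('w, 'ag, 'p) kripke \<Rightarrow> 'w \<Rightarrow> nat \<Rightarrow> 'w set" where
  "near M w k = {v. \<exists>i\<le>k. (w, v) \<in> (\<Union>\<alpha>. acc M \<alpha>) ^^ i}"

lemma near_self [simp]: "w \<in> near M w k"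
  unfolding near_def by (auto intro!: exI[of _ 0])

lemma near_mono: "v \<in> near M w k \<Longrightarrow> k \<le> l \<Longrightarrow> v \<in> near M w l"
  unfolding near_def using order_trans by blast

lemma near_step:
  assumes "u \<in> near M w k" "(u, v) \<in> acc M \<alpha>"
  shows "v \<in> near M w (Suc k)"
proof -
  obtain i where "i \<le> k" "(w, u) \<in> (\<Union>\<alpha>. acc M \<alpha>) ^^ i"
    using assms(1) by (auto simp: near_def)
  then show ?thesis
    using assms(2) unfolding near_def by (fastforce intro!: exI[of _ "Suc i"])
qed

lemma near_worlds:
  assumes "kripke_model M" "w \<in> worlds M" "v \<in> near M w k"
  shows "v \<in> worlds M"
proof -
  have "(w, v) \<in> (\<Union>\<alpha>. acc M \<alpha>) ^^ i \<Longrightarrow> v \<in> worlds M" for i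
    using assms(1,2) by (cases i) (auto simp: kripke_model_def acc_def)
  then show ?thesis
    using assms(3) by (auto simp: near_def)
qed

lemma sat_box_all: "sat M w (box_all \<chi>) \<longleftrightarrow> (\<forall>\<alpha> v. (w, v) \<in> acc M \<alpha> \<longrightarrow> sat M v \<chi>)"
  unfolding box_all_def by (subst sat_big_and) auto

lemma sat_box_all_power:
  "sat M w ((box_all ^^ i) \<chi>) \<longleftrightarrow> (\<forall>v. (w, v) \<in> (\<Union>\<alpha>. acc M \<alpha>) ^^ i \<longrightarrow> sat M v \<chi>)"
proof (induction i arbitrary: w)
  case (Suc i)
  \<comment> \<open>\<open>relpow\<close> splits off the last step, whereas the outermost
    \<open>box_all\<close> speaks about the first one.\<close>
  have relpow_Suc: "(\<Union>\<alpha>. acc M \<alpha>) ^^ Suc i = (\<Union>\<alpha>. acc M \<alpha>) O (\<Union>\<alpha>. acc M \<alpha>) ^^ i"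
    by (simp only: relpow.simps(2) relpow_commute)
  have "sat M w ((box_all ^^ Suc i) \<chi>) \<longleftrightarrow>
      (\<forall>u. (w, u) \<in> (\<Union>\<alpha>. acc M \<alpha>) \<longrightarrow> sat M u ((box_all ^^ i) \<chi>))"
    by (auto simp: sat_box_all)
  also have "\<dots> \<longleftrightarrow> (\<forall>v. (w, v) \<in> (\<Union>\<alpha>. acc M \<alpha>) ^^ Suc i \<longrightarrow> sat M v \<chi>)"
    unfolding Suc.IH relpow_Suc by blast
  finally show ?case .
qed simp

lemma sat_Inv: "sat M w (Inv d \<chi>) \<longleftrightarrow> (\<forall>v\<in>near M w d. sat M v \<chi>)"
  unfolding Inv_def by (subst sat_big_and) (auto simp: sat_box_all_power near_def)

lemma sat_ax_inst:
  "sat M v (ax_inst cD \<alpha> \<psi>) \<longleftrightarrow> (\<exists>v'. (v, v') \<in> acc M \<alpha>)"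
  "sat M v (ax_inst cT \<alpha> \<psi>) \<longleftrightarrow> (sat M v (Box \<alpha> \<psi>) \<longrightarrow> sat M v \<psi>)"
  "sat M v (ax_inst cB \<alpha> \<psi>) \<longleftrightarrow> (sat M v (Dia \<alpha> (Box \<alpha> \<psi>)) \<longrightarrow> sat M v \<psi>)"
  "sat M v (ax_inst c4 \<alpha> \<psi>) \<longleftrightarrow> (sat M v (Box \<alpha> \<psi>) \<longrightarrow> sat M v (Box \<alpha> (Box \<alpha> \<psi>)))"
  "sat M v (ax_inst c5 \<alpha> \<psi>) \<longleftrightarrow> (sat M v (Dia \<alpha> (Box \<alpha> \<psi>)) \<longrightarrow> sat M v (Box \<alpha> \<psi>))"
  by (auto simp: ax_inst_def Imp_def)

text \<open>The sound half of frame correspondence. It serves both directions: for the new condition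
  in models of the stronger logic, and for the old conditions in the model of the
  translation.\<close>

lemma sat_ax_inst_of_cond:
  assumes "v \<in> worlds M" "satisfies_cond (worlds M) (acc M \<alpha>) y"
  shows "sat M v (ax_inst y \<alpha> \<psi>)"
proof (cases y)
  case cD
  then show ?thesis using assms by (auto simp: sat_ax_inst serial_on_def)
next
  case cT
  then show ?thesis using assms by (auto simp: sat_ax_inst refl_on_def)
next
  case cB
  then show ?thesis using assms by (auto simp: sat_ax_inst dest: symD)
next
  case c4
  then have "trans (acc M \<alpha>)" using assms by simp
  then show ?thesis unfolding c4 sat_ax_inst sat.simps by (meson transD)
next
  case c5
  then have "euclidean (acc M \<alpha>)" using assms by simp
  then show ?thesis unfolding c5 sat_ax_inst sat.simps euclidean_def by meson
qed

lemma finite_sub_bar [simp]: "finite (sub_bar \<phi>)"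
  by (simp add: sub_bar_def)

lemma sat_tr:
  "sat M w (tr x A \<phi>) \<longleftrightarrow> sat M w \<phi> \<and>
    (\<forall>v\<in>near M w (tr_depth x \<phi>). \<forall>\<psi>\<in>sub_bar \<phi>. \<forall>\<alpha>\<in>A. sat M v (ax_inst x \<alpha> \<psi>))"
proof -
  have "{ax_inst x \<alpha> \<psi> | \<psi> \<alpha>. \<psi> \<in> sub_bar \<phi> \<and> \<alpha> \<in> A} =
      (\<lambda>(\<psi>, \<alpha>). ax_inst x \<alpha> \<psi>) ` (sub_bar \<phi> \<times> A)"
    by auto
  then have "finite {ax_inst x \<alpha> \<psi> | \<psi> \<alpha>. \<psi> \<in> sub_bar \<phi> \<and> \<alpha> \<in> A}"
    by simp
  then show ?thesis
    by (auto simp: tr_def sat_Inv sat_big_and)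
qed


section \<open>Subformulas\<close>

lemma sub_self [simp]: "\<phi> \<in> sub \<phi>"
  by (cases \<phi>) auto

lemma sub_trans: "\<psi> \<in> sub \<phi> \<Longrightarrow> sub \<psi> \<subseteq> sub \<phi>"
  by (induction \<phi>) auto

lemma neg_in_sub_bar [simp]: "neg \<psi> \<in> sub_bar \<phi> \<longleftrightarrow> \<psi> \<in> sub_bar \<phi>"
  unfolding sub_bar_def by (metis (no_types, opaque_lifting) Un_iff image_iff neg_neg)

text \<open>If the box is only the negation of a subformula, that subformula is
  \<open>Dia \<alpha> (neg \<psi>)\<close>, whose body is \<open>neg \<psi>\<close>. Thus the axioms
  may be instantiated with bodies of relevant boxes.\<close>

lemma sub_bar_bodyD:
  assumes "Box \<alpha> \<psi> \<in> sub_bar \<phi>"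
  shows "\<psi> \<in> sub_bar \<phi>"
proof -
  have body: "\<psi> \<in> sub \<phi>" if "Box \<alpha> \<psi> \<in> sub \<phi> \<or> Dia \<alpha> \<psi> \<in> sub \<phi>" for \<psi>
    using that sub_trans[of _ \<phi>] sub_self[of \<psi>] by fastforce
  have mem: "\<chi> \<in> sub_bar \<phi> \<longleftrightarrow> \<chi> \<in> sub \<phi> \<or> neg \<chi> \<in> sub \<phi>" for \<chi>
    unfolding sub_bar_def by (metis (no_types, opaque_lifting) Un_iff image_iff neg_neg)
  show ?thesis
    using assms body[of \<psi>] body[of "neg \<psi>"] unfolding mem neg.simps by blast
qed

lemma Dia_neg_in_sub_bar: "Dia \<alpha> (neg \<psi>) \<in> sub_bar \<phi> \<longleftrightarrow> Box \<alpha> \<psi> \<in> sub_bar \<phi>"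
  using neg_in_sub_bar[of "Box \<alpha> \<psi>" \<phi>] by simp

lemma ex_nonmodal_sub: "\<exists>\<psi>\<in>sub \<phi>. \<forall>\<alpha> \<chi>. \<psi> \<noteq> Box \<alpha> \<chi> \<and> \<psi> \<noteq> Dia \<alpha> \<chi>"
  by (induction \<phi>) auto

lemma ex_modal_sub: "md \<phi> > 0 \<Longrightarrow> \<exists>\<psi>\<in>sub \<phi>. \<exists>\<alpha> \<chi>. \<psi> = Box \<alpha> \<chi> \<or> \<psi> = Dia \<alpha> \<chi>"
  by (induction \<phi>) (auto simp: less_max_iff_disj)

text \<open>A modal subformula and a non-modal one are distinct. The bound leaves room for the two
  steps that axiom 5 may spend per unit of rank.\<close>

lemma fm_size_ge_2:
  assumes "md \<phi> > 0"
  shows "fm_size \<phi> \<ge> 2"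
proof -
  obtain \<psi> \<chi> where "\<psi> \<in> sub \<phi>" "\<chi> \<in> sub \<phi>" "\<psi> \<noteq> \<chi>"
    using ex_modal_sub[OF assms] ex_nonmodal_sub[of \<phi>] by metis
  then have "card {\<psi>, \<chi>} \<le> card (sub \<phi>)"
    by (intro card_mono) auto
  then show ?thesis
    using \<open>\<psi> \<noteq> \<chi>\<close> by (simp add: fm_size_def)
qed

lemma fm_size_pos: "fm_size \<phi> \<ge> 1"
  unfolding fm_size_def by (metis One_nat_def Suc_leI card_gt_0_iff empty_iff finite_sub sub_self)

text \<open>Each such box or its dual diamond is a subformula; choosing one of them is injective and
  misses a non-modal subformula. Strictness leaves one step of the budget for the move from a parent
  to its child.\<close>

lemma card_boxes_less_fm_size: "card {\<psi>. Box \<alpha> \<psi> \<in> sub_bar \<phi>} < fm_size \<phi>"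
proof -
  define f where "f \<psi> = (if Box \<alpha> \<psi> \<in> sub \<phi> then Box \<alpha> \<psi> else Dia \<alpha> (neg \<psi>))" for \<psi>
  obtain \<chi> where \<chi>: "\<chi> \<in> sub \<phi>" "\<And>\<alpha> \<chi>'. \<chi> \<noteq> Box \<alpha> \<chi>' \<and> \<chi> \<noteq> Dia \<alpha> \<chi>'"
    using ex_nonmodal_sub[of \<phi>] by blast
  have inj: "inj f"
    by (rule injI) (auto simp: f_def split: if_splits dest: arg_cong[of _ _ neg])
  have "f ` {\<psi>. Box \<alpha> \<psi> \<in> sub_bar \<phi>} \<subseteq> sub \<phi>"
  proof clarify
    fix \<psi> assume "Box \<alpha> \<psi> \<in> sub_bar \<phi>"
    then have "Box \<alpha> \<psi> \<in> sub \<phi> \<or> neg (Box \<alpha> \<psi>) \<in> sub \<phi>"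
      unfolding sub_bar_def by (metis (no_types, opaque_lifting) Un_iff image_iff neg_neg)
    then show "f \<psi> \<in> sub \<phi>" by (auto simp: f_def)
  qed
  moreover have "\<chi> \<notin> f ` {\<psi>. Box \<alpha> \<psi> \<in> sub_bar \<phi>}"
    using \<chi>(2) by (auto simp: f_def split: if_splits)
  ultimately have "f ` {\<psi>. Box \<alpha> \<psi> \<in> sub_bar \<phi>} \<subset> sub \<phi>"
    using \<chi>(1) by blast
  then have "card (f ` {\<psi>. Box \<alpha> \<psi> \<in> sub_bar \<phi>}) < card (sub \<phi>)"
    by (rule psubset_card_mono[OF finite_sub])
  then show ?thesis
    using inj by (simp add: fm_size_def card_image inj_on_subset)
qed


section \<open>Countable submodels\<close>

instance fm :: (countable, countable) countable
  by countable_datatype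

text \<open>One chosen witness for each true diamond, iterated from \<open>w\<close>, yields
  countably many worlds, because there are countably many formulas; a countable set embeds into any
  infinite type. Truth survives since witnesses are kept.\<close>

lemma satisfiable_of_model:
  fixes M :: "('v, 'ag::finite, 'p::finite) kripke"
  assumes model: "L_model L M" and w: "w \<in> worlds M" and \<phi>: "sat M w \<phi>"
  shows "satisfiable TYPE('w::infinite) L \<phi>"
proof -
  \<comment> \<open>A request without a witness leaves the world unchanged, so every list of
    requests names a world.\<close>
  define step where "step u q = (case q of (\<alpha>, \<psi>) \<Rightarrow>
      if \<exists>v. (u, v) \<in> acc M \<alpha> \<and> sat M v \<psi> then SOME v. (u, v) \<in> acc M \<alpha> \<and> sat M v \<psi> else u)"
    for u and q :: "'ag \<times> ('ag, 'p) fm"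
  define W where "W = range (foldl step w)"
  have acc_worlds: "u \<in> worlds M \<and> v \<in> worlds M" if "(u, v) \<in> acc M \<alpha>" for u v \<alpha>
    using model that by (auto simp: L_model_def kripke_model_def acc_def)
  have witness: "\<exists>v\<in>W. (u, v) \<in> acc M \<alpha> \<and> sat M v \<psi>"
    if "u \<in> W" and ex: "\<exists>v. (u, v) \<in> acc M \<alpha> \<and> sat M v \<psi>" for u \<alpha> \<psi>
  proof -
    obtain qs where "u = foldl step w qs"
      using \<open>u \<in> W\<close> by (auto simp: W_def)
    then have "step u (\<alpha>, \<psi>) = foldl step w (qs @ [(\<alpha>, \<psi>)])"
      by simp
    then have "step u (\<alpha>, \<psi>) \<in> W"
      unfolding W_def by blast
    moreover have "(u, step u (\<alpha>, \<psi>)) \<in> acc M \<alpha> \<and> sat M (step u (\<alpha>, \<psi>)) \<psi>"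
      using someI_ex[OF ex] ex by (simp add: step_def)
    ultimately show ?thesis by blast
  qed
  have wW: "w \<in> W"
    unfolding W_def by (rule range_eqI[of _ _ "[]"]) simp
  have step_world: "u \<in> worlds M \<Longrightarrow> step u q \<in> worlds M" for u q
  proof (cases q)
    case (Pair \<alpha> \<psi>)
    show "step u q \<in> worlds M" if "u \<in> worlds M"
      using that someI_ex[of "\<lambda>v. (u, v) \<in> acc M \<alpha> \<and> sat M v \<psi>"]
      by (auto simp: step_def Pair dest: acc_worlds)
  qed
  have "foldl step w qs \<in> worlds M" for qs
    by (induction qs rule: rev_induct) (auto simp: w step_world)
  then have sub: "W \<subseteq> worlds M"
    by (auto simp: W_def)
  have "countable W"
    by (simp add: W_def)
  moreover obtain g :: "nat \<Rightarrow> 'w" where "inj g"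
    using infinite_countable_subset[OF infinite_UNIV] by blast
  ultimately obtain f :: "'v \<Rightarrow> 'w" where f: "inj_on f W"
    by (metis comp_inj_on inj_on_subset inj_on_to_nat_on subset_UNIV)
  define M' where "M' = \<lparr>worlds = f ` W,
     rel = {(f u, \<alpha>, f v) | u \<alpha> v. u \<in> W \<and> v \<in> W \<and> (u, v) \<in> acc M \<alpha>},
     val = \<lambda>p. f ` (W \<inter> val M p)\<rparr>"
  have acc': "acc M' \<alpha> = {(f u, f v) | u v. u \<in> W \<and> v \<in> W \<and> (u, v) \<in> acc M \<alpha>}" for \<alpha>
    by (auto simp: M'_def acc_def)
  have acc_iff: "(f u, f v) \<in> acc M' \<alpha> \<longleftrightarrow> (u, v) \<in> acc M \<alpha>" if "u \<in> W" "v \<in> W" for u v \<alpha>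
    using that f unfolding acc' by (auto dest: inj_onD)
  have acc_image: "(y, z) \<in> acc M' \<alpha> \<Longrightarrow> y \<in> f ` W \<and> z \<in> f ` W" for y z \<alpha>
    unfolding acc' by auto
  have acc_from: "(f u, z) \<in> acc M' \<alpha> \<longleftrightarrow> (\<exists>v\<in>W. z = f v \<and> (u, v) \<in> acc M \<alpha>)" if "u \<in> W" for u z \<alpha>
    using that f unfolding acc' by (auto dest: inj_onD)
  have sat_iff: "u \<in> W \<Longrightarrow> sat M' (f u) \<psi> \<longleftrightarrow> sat M u \<psi>" for u \<psi>
  proof (induction \<psi> arbitrary: u)
    case (Prop p)
    then show ?case using f by (auto simp: M'_def dest: inj_onD)
  next
    case (NProp p)
    then show ?case using f by (auto simp: M'_def dest: inj_onD)
  next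
    case (Dia \<alpha> \<psi>)
    have "sat M' (f u) (Dia \<alpha> \<psi>) \<longleftrightarrow> (\<exists>v\<in>W. (u, v) \<in> acc M \<alpha> \<and> sat M v \<psi>)"
      using Dia by (auto simp: acc_from)
    then show ?case using witness[OF Dia.prems, of \<alpha> \<psi>] by auto
  next
    case (Box \<alpha> \<psi>)
    have "sat M' (f u) (Box \<alpha> \<psi>) \<longleftrightarrow> (\<forall>v\<in>W. (u, v) \<in> acc M \<alpha> \<longrightarrow> sat M v \<psi>)"
      using Box by (auto simp: acc_from)
    then show ?case using witness[OF Box.prems, of \<alpha> "neg \<psi>"] by auto
  qed auto
  have "satisfies_cond (worlds M') (acc M' \<alpha>) y" if "y \<in> L \<alpha>" for \<alpha> y
  proof -
    have cond: "satisfies_cond (worlds M) (acc M \<alpha>) y"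
      using model that by (auto simp: L_model_def)
    have worlds': "worlds M' = f ` W" by (simp add: M'_def)
    show ?thesis
    proof (cases y)
      case cD
      have "\<exists>v\<in>W. (u, v) \<in> acc M \<alpha>" if "u \<in> W" for u
      proof -
        have "\<exists>v. (u, v) \<in> acc M \<alpha>"
          using cond that sub cD by (auto simp: serial_on_def)
        \<comment> \<open>Unlike the other conditions, seriality does not pass to arbitrary subsets;
          the witnesses for \<open>TT\<close> provide it.\<close>
        then show ?thesis using witness[OF that, of \<alpha> TT] by simp
      qed
      then show ?thesis using cD acc_iff by (fastforce simp: worlds' serial_on_def)
    next
      case cT
      then show ?thesis using cond sub acc_iff acc_image
        by (auto simp: worlds' refl_on_def)
    next
      case cB
      then show ?thesis using cond unfolding acc' by (fastforce intro!: symI dest: symD)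
    next
      case c4
      then have "trans (acc M \<alpha>)" using cond by simp
      have "trans (acc M' \<alpha>)"
      proof (rule transI)
        fix a b c assume "(a, b) \<in> acc M' \<alpha>" "(b, c) \<in> acc M' \<alpha>"
        moreover from this obtain a' b' c' where "a = f a'" "b = f b'" "c = f c'"
          "a' \<in> W" "b' \<in> W" "c' \<in> W" using acc_image by blast
        ultimately show "(a, c) \<in> acc M' \<alpha>"
          using \<open>trans (acc M \<alpha>)\<close> by (auto simp: acc_iff dest: transD)
      qed
      then show ?thesis using c4 by simp
    next
      case c5
      then have "euclidean (acc M \<alpha>)" using cond by simp
      have "euclidean (acc M' \<alpha>)"
        unfolding euclidean_def
      proof (intro allI impI)
        fix a b c assume "(a, b) \<in> acc M' \<alpha>" "(a, c) \<in> acc M' \<alpha>"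
        moreover from this obtain a' b' c' where "a = f a'" "b = f b'" "c = f c'"
          "a' \<in> W" "b' \<in> W" "c' \<in> W" using acc_image by blast
        ultimately show "(b, c) \<in> acc M' \<alpha>"
          using \<open>euclidean (acc M \<alpha>)\<close>[unfolded euclidean_def, rule_format, of a' b' c']
          by (simp add: acc_iff)
      qed
      then show ?thesis using c5 by simp
    qed
  qed
  moreover have "kripke_model M'"
    using wW by (auto simp: kripke_model_def M'_def)
  ultimately have "L_model L M'"
    by (simp add: L_model_def)
  moreover have "f w \<in> worlds M'" "sat M' (f w) \<phi>"
    using wW sat_iff \<phi> by (auto simp: M'_def)
  ultimately show ?thesis
    unfolding satisfiable_def by blast
qed


section \<open>The model of nodes\<close>

text \<open>\<open>L\<close> will be the stronger logic, and \<open>c\<close> is the number of steps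
  of \<open>M\<close> that one unit of modal depth may cost.\<close>

locale axioms_nearby =
  fixes M :: "('v, 'ag::finite, 'p) kripke" and w :: 'v
    and \<phi> :: "('ag, 'p) fm" and L :: "'ag \<Rightarrow> cond set" and c :: nat
  assumes sat_\<phi>: "sat M w \<phi>"
    and axioms: "\<And>v y \<alpha> \<psi>. v \<in> near M w (md \<phi> * c) \<Longrightarrow> y \<in> L \<alpha> \<Longrightarrow> \<psi> \<in> sub_bar \<phi> \<Longrightarrow>
      sat M v (ax_inst y \<alpha> \<psi>)"
    and c_pos: "c \<ge> 1"
    and c_eq: "\<And>\<alpha>. c4 \<in> L \<alpha> \<or> c5 \<in> L \<alpha> \<Longrightarrow> c = fm_size \<phi>"
begin

abbreviation range_M :: "'v set" where
  "range_M \<equiv> near M w (md \<phi> * c)"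

definition boxes :: "'ag \<Rightarrow> 'v \<Rightarrow> ('ag, 'p) fm set" where
  "boxes \<alpha> u = {\<psi>. Box \<alpha> \<psi> \<in> sub_bar \<phi> \<and> sat M u (Box \<alpha> \<psi>)}"

lemma boxesD: "\<psi> \<in> boxes \<alpha> u \<Longrightarrow> (u, v) \<in> acc M \<alpha> \<Longrightarrow> sat M v \<psi>"
  by (auto simp: boxes_def)

lemma boxes_bodyD: "\<psi> \<in> boxes \<alpha> u \<Longrightarrow> \<psi> \<in> sub_bar \<phi>"
  using sub_bar_bodyD by (auto simp: boxes_def)

lemma boxes_sat: "\<psi> \<in> boxes \<alpha> u \<Longrightarrow> sat M u (Box \<alpha> \<psi>)"
  by (simp add: boxes_def)

lemma finite_boxes: "finite (boxes \<alpha> u)"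
  and card_boxes_less: "card (boxes \<alpha> u) < fm_size \<phi>"
proof -
  have fin: "finite {\<psi>. Box \<alpha> \<psi> \<in> sub_bar \<phi>}"
    using finite_vimageI[OF finite_sub_bar, of "Box \<alpha>"] by (simp add: inj_def vimage_def)
  then show "finite (boxes \<alpha> u)"
    by (rule rev_finite_subset) (auto simp: boxes_def)
  have "card (boxes \<alpha> u) \<le> card {\<psi>. Box \<alpha> \<psi> \<in> sub_bar \<phi>}"
    using fin by (intro card_mono) (auto simp: boxes_def)
  then show "card (boxes \<alpha> u) < fm_size \<phi>"
    using card_boxes_less_fm_size[of \<alpha> \<phi>] by linarith
qed

section \<open>Consequences of the axioms for box sets\<close>

lemma axiom_D: "u \<in> range_M \<Longrightarrow> cD \<in> L \<alpha> \<Longrightarrow> \<exists>v. (u, v) \<in> acc M \<alpha>"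
  using axioms[of u cD \<alpha> \<phi>] by (simp add: sat_ax_inst sub_bar_def)

lemma axiom_T: "u \<in> range_M \<Longrightarrow> cT \<in> L \<alpha> \<Longrightarrow> \<psi> \<in> sub_bar \<phi> \<Longrightarrow> sat M u (Box \<alpha> \<psi>) \<Longrightarrow> sat M u \<psi>"
  using axioms[of u cT \<alpha> \<psi>] unfolding sat_ax_inst by blast

lemma axiom_B: "u \<in> range_M \<Longrightarrow> cB \<in> L \<alpha> \<Longrightarrow> \<psi> \<in> sub_bar \<phi> \<Longrightarrow> (u, v) \<in> acc M \<alpha> \<Longrightarrow>
    sat M v (Box \<alpha> \<psi>) \<Longrightarrow> sat M u \<psi>"
  using axioms[of u cB \<alpha> \<psi>] unfolding sat_ax_inst sat.simps(7) by blast

lemma axiom_4: "u \<in> range_M \<Longrightarrow> c4 \<in> L \<alpha> \<Longrightarrow> \<psi> \<in> sub_bar \<phi> \<Longrightarrow> sat M u (Box \<alpha> \<psi>) \<Longrightarrow>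
    (u, v) \<in> acc M \<alpha> \<Longrightarrow> sat M v (Box \<alpha> \<psi>)"
  using axioms[of u c4 \<alpha> \<psi>] unfolding sat_ax_inst by simp

lemma axiom_5: "u \<in> range_M \<Longrightarrow> c5 \<in> L \<alpha> \<Longrightarrow> \<psi> \<in> sub_bar \<phi> \<Longrightarrow> (u, v) \<in> acc M \<alpha> \<Longrightarrow>
    sat M v (Box \<alpha> \<psi>) \<Longrightarrow> sat M u (Box \<alpha> \<psi>)"
  using axioms[of u c5 \<alpha> \<psi>] unfolding sat_ax_inst sat.simps(7) by blast

lemma sat_boxes_T: "u \<in> range_M \<Longrightarrow> cT \<in> L \<alpha> \<Longrightarrow> \<psi> \<in> boxes \<alpha> u \<Longrightarrow> sat M u \<psi>"
  using axiom_T boxes_bodyD boxes_sat by blast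

lemma sat_boxes_B:
  "u \<in> range_M \<Longrightarrow> cB \<in> L \<alpha> \<Longrightarrow> (u, v) \<in> acc M \<alpha> \<Longrightarrow> \<psi> \<in> boxes \<alpha> v \<Longrightarrow> sat M u \<psi>"
  using axiom_B boxes_bodyD boxes_sat by blast

lemma boxes_mono_4:
  "u \<in> range_M \<Longrightarrow> c4 \<in> L \<alpha> \<Longrightarrow> (u, v) \<in> acc M \<alpha> \<Longrightarrow> boxes \<alpha> u \<subseteq> boxes \<alpha> v"
  using axiom_4[of u \<alpha> _ v] sub_bar_bodyD[of \<alpha> _ \<phi>]
  by (auto simp: boxes_def simp del: sat.simps)

text \<open>Axiom 4 turns a box at \<open>v\<close> into a double box, and axiom B for
  \<open>Box \<alpha> \<psi>\<close> itself, which lies in \<open>sub_bar \<phi>\<close>, carries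
  the inner box back to \<open>u\<close>.\<close>

lemma boxes_antimono_4B:
  assumes "u \<in> range_M" "v \<in> range_M" "c4 \<in> L \<alpha>" "cB \<in> L \<alpha>" "(u, v) \<in> acc M \<alpha>"
  shows "boxes \<alpha> v \<subseteq> boxes \<alpha> u"
proof
  fix \<psi> assume "\<psi> \<in> boxes \<alpha> v"
  then have \<psi>: "Box \<alpha> \<psi> \<in> sub_bar \<phi>" "sat M v (Box \<alpha> \<psi>)"
    by (auto simp: boxes_def)
  then have "sat M v (Box \<alpha> (Box \<alpha> \<psi>))"
    using axiom_4[of v \<alpha> \<psi>] assms sub_bar_bodyD[OF \<psi>(1)] \<psi>(2) by (subst sat.simps(8)) blast
  then have "sat M u (Box \<alpha> \<psi>)"
    using axiom_B[of u \<alpha> "Box \<alpha> \<psi>"] assms \<psi> by blast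
  then show "\<psi> \<in> boxes \<alpha> u"
    using \<psi> by (simp add: boxes_def)
qed

lemma boxes_antimono_5:
  "u \<in> range_M \<Longrightarrow> c5 \<in> L \<alpha> \<Longrightarrow> (u, v) \<in> acc M \<alpha> \<Longrightarrow> boxes \<alpha> v \<subseteq> boxes \<alpha> u"
  using axiom_5[of u \<alpha> _ v] sub_bar_bodyD[of \<alpha> _ \<phi>]
  by (auto simp: boxes_def simp del: sat.simps)

lemma Box_Dia_neg_self_5:
  assumes "v \<in> range_M" "c5 \<in> L \<alpha>" "Box \<alpha> \<psi> \<in> sub_bar \<phi>" "\<not> sat M v (Box \<alpha> \<psi>)"
  shows "sat M v (Box \<alpha> (Dia \<alpha> (neg \<psi>)))"
proof -
  have "\<not> sat M v' (Box \<alpha> \<psi>)" if "(v, v') \<in> acc M \<alpha>" for v'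
    using axiom_5[of v \<alpha> \<psi> v'] that assms sub_bar_bodyD[of \<alpha> \<psi> \<phi>] by blast
  then show ?thesis by simp
qed

text \<open>Siblings agree on boxes because axiom 5 is available for the dual diamond as well as for its
  body, \<^const>\<open>sub_bar\<close> being closed under negation.\<close>

lemma Box_Dia_neg_5:
  assumes "u \<in> range_M" "v \<in> range_M" "c5 \<in> L \<alpha>" "(u, v) \<in> acc M \<alpha>"
    "Box \<alpha> \<psi> \<in> sub_bar \<phi>" "\<not> sat M v (Box \<alpha> \<psi>)"
  shows "sat M u (Box \<alpha> (Dia \<alpha> (neg \<psi>)))"
proof -
  have "Dia \<alpha> (neg \<psi>) \<in> sub_bar \<phi>"
    using assms by (simp add: Dia_neg_in_sub_bar)
  moreover have "sat M v (Box \<alpha> (Dia \<alpha> (neg \<psi>)))"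
    using Box_Dia_neg_self_5 assms by blast
  ultimately show ?thesis
    using axiom_5[of u \<alpha> "Dia \<alpha> (neg \<psi>)" v] assms by blast
qed

text \<open>The right-hand side depends on \<open>u\<close> only, so the successors of
  \<open>u\<close> share one box set.\<close>

lemma boxes_eq_5_siblings:
  assumes "u \<in> range_M" "v \<in> range_M" "c5 \<in> L \<alpha>" "(u, v) \<in> acc M \<alpha>"
  shows "boxes \<alpha> v = {\<psi>. Box \<alpha> \<psi> \<in> sub_bar \<phi> \<and> sat M u (Dia \<alpha> (Box \<alpha> \<psi>))}"
proof (intro set_eqI iffI)
  fix \<psi> assume "\<psi> \<in> {\<psi>. Box \<alpha> \<psi> \<in> sub_bar \<phi> \<and> sat M u (Dia \<alpha> (Box \<alpha> \<psi>))}"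
  then show "\<psi> \<in> boxes \<alpha> v"
    using Box_Dia_neg_5[OF assms, of \<psi>] by (auto simp: boxes_def)
qed (use assms(4) in \<open>auto simp: boxes_def\<close>)

text \<open>A box true at \<open>v\<close> but not at \<open>v'\<close> would give
  \<open>Box \<alpha> (Dia \<alpha> (neg \<psi>))\<close> at \<open>v\<close>, hence at
  \<open>u\<close> by axiom 5 for the diamond, hence the diamond at \<open>v\<close> itself, a
  contradiction.\<close>

lemma boxes_eq_5_grandchild:
  assumes "u \<in> range_M" "v \<in> range_M" "v' \<in> range_M" "c5 \<in> L \<alpha>"
    "(u, v) \<in> acc M \<alpha>" "(v, v') \<in> acc M \<alpha>"
  shows "boxes \<alpha> v' = boxes \<alpha> v"
proof
  show "boxes \<alpha> v \<subseteq> boxes \<alpha> v'"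
  proof
    fix \<psi> assume \<psi>: "\<psi> \<in> boxes \<alpha> v"
    show "\<psi> \<in> boxes \<alpha> v'"
    proof (rule ccontr)
      assume "\<psi> \<notin> boxes \<alpha> v'"
      then have "sat M v (Box \<alpha> (Dia \<alpha> (neg \<psi>)))"
        using Box_Dia_neg_5[of v v' \<alpha> \<psi>] assms \<psi> unfolding boxes_def by blast
      moreover have "Dia \<alpha> (neg \<psi>) \<in> sub_bar \<phi>"
        using \<psi> by (simp add: Dia_neg_in_sub_bar boxes_def)
      ultimately have "sat M u (Box \<alpha> (Dia \<alpha> (neg \<psi>)))"
        using axiom_5[of u \<alpha> "Dia \<alpha> (neg \<psi>)" v] assms by blast
      then show False
        using \<psi> assms(5) by (auto simp: boxes_def)
    qed
  qed
qed (use assms boxes_antimono_5 in blast)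

text \<open>With T, B or 4 next to 5, box sets are constant along \<alpha>-steps. In the remaining
  case, with or without D, a world may satisfy more boxes than its successors.\<close>

definition euc_only :: "'ag \<Rightarrow> bool" where
  "euc_only \<alpha> \<longleftrightarrow> c5 \<in> L \<alpha> \<and> cT \<notin> L \<alpha> \<and> cB \<notin> L \<alpha> \<and> c4 \<notin> L \<alpha>"

text \<open>Axiom 5 gives one inclusion, axiom 4 the other. In place of 4, suppose a box of
  \<open>u\<close> is lost at \<open>v\<close>: then
  \<open>Box \<alpha> (Dia \<alpha> (neg \<psi>))\<close> holds at both \<open>u\<close> and
  \<open>v\<close>, and T at \<open>u\<close> or B along the step puts the diamond at
  \<open>u\<close>, a contradiction.\<close>

lemma boxes_eq_5_full:
  assumes "u \<in> range_M" "v \<in> range_M" "c5 \<in> L \<alpha>" "\<not> euc_only \<alpha>" "(u, v) \<in> acc M \<alpha>"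
  shows "boxes \<alpha> v = boxes \<alpha> u"
proof
  show "boxes \<alpha> u \<subseteq> boxes \<alpha> v"
  proof (cases "c4 \<in> L \<alpha>")
    case True
    then show ?thesis using boxes_mono_4 assms by blast
  next
    case False
    then have TB: "cT \<in> L \<alpha> \<or> cB \<in> L \<alpha>"
      using assms by (auto simp: euc_only_def)
    show ?thesis
    proof
      fix \<psi> assume \<psi>: "\<psi> \<in> boxes \<alpha> u"
      then have D: "Dia \<alpha> (neg \<psi>) \<in> sub_bar \<phi>" and B: "Box \<alpha> \<psi> \<in> sub_bar \<phi>"
        by (auto simp: Dia_neg_in_sub_bar boxes_def)
      show "\<psi> \<in> boxes \<alpha> v"
      proof (rule ccontr)
        assume "\<psi> \<notin> boxes \<alpha> v"
        then have no: "\<not> sat M v (Box \<alpha> \<psi>)"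
          using B by (simp add: boxes_def)
        then have "sat M u (Box \<alpha> (Dia \<alpha> (neg \<psi>)))"
          using Box_Dia_neg_5[of u v \<alpha> \<psi>] assms B by blast
        moreover have "sat M v (Box \<alpha> (Dia \<alpha> (neg \<psi>)))"
          using Box_Dia_neg_self_5 assms B no by blast
        ultimately have "sat M u (Dia \<alpha> (neg \<psi>))"
          using TB axiom_T[of u \<alpha>, OF _ _ D] axiom_B[of u \<alpha>, OF _ _ D] assms by blast
        then show False
          using \<psi> by (auto simp: boxes_def)
      qed
    qed
  qed
qed (use assms boxes_antimono_5 in blast)

section \<open>Nodes and their accessibility relations\<close>

text \<open>A node \<open>(v, n, a)\<close> is meant to satisfy the subformulas of modal depth at most \<open>n\<close> that hold
  at \<open>v\<close>. The tag \<open>a = Some \<alpha>\<close> records that the node was entered by an \<open>\<alpha>\<close>-step for a transitive or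
  euclidean \<open>\<alpha>\<close>; further \<open>\<alpha>\<close>-steps then keep \<open>n\<close>. The budget \<open>base n\<close> bounds the distance
  of \<open>v\<close> from \<open>w\<close> in \<open>M\<close>.\<close>

type_synonym ('x, 'y) node = "'x \<times> nat \<times> 'y option"

abbreviation world :: "('v, 'ag) node \<Rightarrow> 'v" where "world s \<equiv> fst s"
abbreviation rank :: "('v, 'ag) node \<Rightarrow> nat" where "rank s \<equiv> fst (snd s)"
abbreviation tag :: "('v, 'ag) node \<Rightarrow> 'ag option" where "tag s \<equiv> snd (snd s)"

definition base :: "nat \<Rightarrow> nat" where
  "base n = (md \<phi> - n) * c"

definition persistent :: "'ag \<Rightarrow> bool" where
  "persistent \<alpha> \<longleftrightarrow> c4 \<in> L \<alpha> \<or> c5 \<in> L \<alpha>"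

text \<open>For axiom 4 the box sets grow along \<open>\<alpha>\<close>-steps, and only a strict growth has to be paid
  for: if the box set does not grow from \<open>u\<close> to \<open>v\<close>, then \<open>u\<close> can witness the diamonds of \<open>v\<close>.\<close>

definition parent :: "'ag \<Rightarrow> nat \<Rightarrow> 'v \<Rightarrow> bool" where
  "parent \<alpha> b u \<longleftrightarrow> (if c5 \<in> L \<alpha> then u \<in> near M w b \<or> (\<exists>u'\<in>near M w b. (u', u) \<in> acc M \<alpha>)
    else u \<in> near M w (b + card (boxes \<alpha> u)))"

text \<open>A tagged node of rank \<open>n\<close> belongs to a cluster entered at rank
  \<open>Suc n\<close>, so its parent is measured against \<open>base (Suc n)\<close>. The parent
  only has to exist and is not recorded.\<close>

definition nodes :: "('v, 'ag) node set" where
  "nodes = {(v, n, a). n \<le> md \<phi> \<and> (case a of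
      None \<Rightarrow> v \<in> near M w (base n)
    | Some \<alpha> \<Rightarrow> persistent \<alpha> \<and> n < md \<phi> \<and>
        (\<exists>u. (u, v) \<in> acc M \<alpha> \<and> parent \<alpha> (base (Suc n)) u))}"

text \<open>The rank at which the \<alpha>-cluster was, or would be, entered; it stays constant
  inside the cluster.\<close>

definition level :: "'ag \<Rightarrow> ('v, 'ag) node \<Rightarrow> nat" where
  "level \<alpha> s = (if tag s = Some \<alpha> then Suc (rank s) else rank s)"

text \<open>In a frame that is merely euclidean, the entry point of a cluster may satisfy more boxes
  than the cluster; its profile is the box set of the cluster.\<close>

definition profile :: "'ag \<Rightarrow> ('v, 'ag) node \<Rightarrow> ('ag, 'p) fm set" where
  "profile \<alpha> s = (if euc_only \<alpha> \<and> tag s \<noteq> Some \<alpha>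
    then {\<psi>. Box \<alpha> \<psi> \<in> sub_bar \<phi> \<and> sat M (world s) (Dia \<alpha> (Box \<alpha> \<psi>))}
    else boxes \<alpha> (world s))"

definition edge :: "'ag \<Rightarrow> ('v, 'ag) node \<Rightarrow> ('v, 'ag) node \<Rightarrow> bool" where
  "edge \<alpha> s t \<longleftrightarrow>
    (\<forall>\<psi>\<in>boxes \<alpha> (world s). sat M (world t) \<psi>) \<and>
    (cB \<in> L \<alpha> \<longrightarrow> (\<forall>\<psi>\<in>boxes \<alpha> (world t). sat M (world s) \<psi>)) \<and>
    (if c5 \<in> L \<alpha> then profile \<alpha> s = profile \<alpha> t \<and> (euc_only \<alpha> \<longrightarrow> tag t = Some \<alpha>)
     else if c4 \<in> L \<alpha> then boxes \<alpha> (world s) \<subseteq> boxes \<alpha> (world t) \<and>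
       (cB \<in> L \<alpha> \<longrightarrow> boxes \<alpha> (world t) \<subseteq> boxes \<alpha> (world s))
     else True)"

text \<open>Without 4 and 5, ranks may differ by one in either direction or agree, which admits B
  and T. With 4 or 5, composed steps must not lower the rank further, so a single level is
  fixed.\<close>

definition adjacent :: "'ag \<Rightarrow> ('v, 'ag) node \<Rightarrow> ('v, 'ag) node \<Rightarrow> bool" where
  "adjacent \<alpha> s t \<longleftrightarrow> (if persistent \<alpha> then level \<alpha> s = level \<alpha> t \<and> level \<alpha> s > 0
    else rank s \<le> Suc (rank t) \<and> rank t \<le> Suc (rank s))"

text \<open>At level 0 no modal depth is left for \<alpha>, and the loop provides D and T without a
  witness from \<open>M\<close>.\<close>

definition step :: "'ag \<Rightarrow> ('v, 'ag) node \<Rightarrow> ('v, 'ag) node \<Rightarrow> bool" where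
  "step \<alpha> s t \<longleftrightarrow> level \<alpha> s = 0 \<and> s = t \<or> adjacent \<alpha> s t \<and> edge \<alpha> s t"

definition node_model :: "(('v, 'ag) node, 'ag, 'p) kripke" where
  "node_model = \<lparr>worlds = nodes,
     rel = {(s, \<alpha>, t). s \<in> nodes \<and> t \<in> nodes \<and> step \<alpha> s t},
     val = \<lambda>p. {s \<in> nodes. world s \<in> val M p}\<rparr>"

lemma acc_node_model: "(s, t) \<in> acc node_model \<alpha> \<longleftrightarrow> s \<in> nodes \<and> t \<in> nodes \<and> step \<alpha> s t"
  by (simp add: acc_def node_model_def)

section \<open>Distance budgets and witnesses for diamonds\<close>

lemma base_Suc: "n < md \<phi> \<Longrightarrow> base n = base (Suc n) + c"
  unfolding base_def by (metis Suc_diff_Suc add.commute mult_Suc)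

lemma base_le: "base n \<le> md \<phi> * c"
  by (simp add: base_def)

lemma c_ge_2: "persistent \<alpha> \<Longrightarrow> md \<phi> > 0 \<Longrightarrow> c \<ge> 2"
  using c_eq[of \<alpha>] fm_size_ge_2[of \<phi>] by (auto simp: persistent_def)

text \<open>One unit of rank buys \<open>c\<close> steps. Under 5, \<open>u\<close> and
  \<open>v\<close> lie at most one and two steps beyond \<open>base (Suc n)\<close>, and
  \<open>c\<close> is at least 2. Otherwise the strict bound on the size of box sets pays for
  both.\<close>

lemma parent_near:
  assumes "persistent \<alpha>" "n < md \<phi>" "parent \<alpha> (base (Suc n)) u" "(u, v) \<in> acc M \<alpha>"
  shows "u \<in> near M w (base n)" "v \<in> near M w (base n)"
proof -
  have "v \<in> near M w (base n) \<and> u \<in> near M w (base n)"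
  proof (cases "c5 \<in> L \<alpha>")
    case True
    have "c \<ge> 2" using c_ge_2 assms by auto
    then have *: "Suc (base (Suc n)) \<le> base n" "Suc (Suc (base (Suc n))) \<le> base n"
      using base_Suc[OF assms(2)] by linarith+
    have "u \<in> near M w (Suc (base (Suc n)))"
      using assms(3) True near_step[of _ M w "base (Suc n)" u \<alpha>]
        near_mono[of u M w "base (Suc n)" "Suc (base (Suc n))"] by (auto simp: parent_def)
    from near_mono[OF near_step[OF this assms(4)] *(2)] near_mono[OF this *(1)]
    show ?thesis ..
  next
    case False
    then have "c4 \<in> L \<alpha>" using assms by (auto simp: persistent_def)
    then have "c = fm_size \<phi>" using c_eq by blast
    then have "Suc (base (Suc n) + card (boxes \<alpha> u)) \<le> base n"
      "base (Suc n) + card (boxes \<alpha> u) \<le> base n"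
      using base_Suc[OF assms(2)] card_boxes_less[of \<alpha> u] by linarith+
    then show ?thesis
      using assms(3,4) False near_step[of u M w _ v \<alpha>] near_mono unfolding parent_def by metis
  qed
  then show "u \<in> near M w (base n)" "v \<in> near M w (base n)" by auto
qed

lemma node_near: "s \<in> nodes \<Longrightarrow> world s \<in> near M w (base (rank s))"
  unfolding nodes_def using parent_near by (fastforce split: option.splits)

lemma node_range: "s \<in> nodes \<Longrightarrow> world s \<in> range_M"
  using near_mono[OF node_near base_le] .

lemma parent_of_near: "u \<in> near M w b \<Longrightarrow> parent \<alpha> b u"
  unfolding parent_def using near_mono[of u M w b] by auto

text \<open>A relevant diamond is the dual of a relevant box, so equal box sets share it. The
  formula \<open>Dia \<alpha> TT\<close>, wanted for seriality, may be irrelevant, but there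
  \<open>v\<close> is the witness.\<close>

lemma boxes_eq_sat_Dia:
  assumes "boxes \<alpha> u = boxes \<alpha> v" "(u, v) \<in> acc M \<alpha>" "sat M v (Dia \<alpha> \<chi>)"
    "Dia \<alpha> \<chi> \<in> sub_bar \<phi> \<or> \<chi> = TT"
  shows "sat M u (Dia \<alpha> \<chi>)"
proof (cases "\<chi> = TT")
  case False
  then have "Box \<alpha> (neg \<chi>) \<in> sub_bar \<phi>"
    using assms(4) Dia_neg_in_sub_bar[of \<alpha> "neg \<chi>" \<phi>] by simp
  moreover have "neg \<chi> \<notin> boxes \<alpha> v"
    using assms(3) by (auto simp: boxes_def)
  then have "neg \<chi> \<notin> boxes \<alpha> u"
    using assms(1) by simp
  ultimately show ?thesis
    by (auto simp: boxes_def)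
qed (use assms(2) in auto)

lemma edge_from_entry:
  assumes "u \<in> range_M" "v \<in> range_M" "(u, v) \<in> acc M \<alpha>" "world s = u" "world t = v"
    "tag s \<noteq> Some \<alpha> \<or> c5 \<notin> L \<alpha>" "tag t = (if persistent \<alpha> then Some \<alpha> else None)"
  shows "edge \<alpha> s t"
  unfolding edge_def
proof (intro conjI impI ballI, goal_cases)
  case (1 \<psi>)
  then show ?case using boxesD assms by blast
next
  case (2 \<psi>)
  then show ?case using sat_boxes_B assms by blast
next
  case 3
  show ?case
  proof (cases "c5 \<in> L \<alpha>")
    case True
    then have "persistent \<alpha>" by (simp add: persistent_def)
    then show ?thesis
      using True boxes_eq_5_siblings[of u v \<alpha>] boxes_eq_5_full[of u v \<alpha>] assms
      by (auto simp: profile_def)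
  next
    case False
    then show ?thesis
      using boxes_mono_4[of u \<alpha> v] boxes_antimono_4B[of u v \<alpha>] assms by auto
  qed
qed

text \<open>The witness must stay within the budget of the same rank. Under 5, if \<open>u\<close>
  is within the base distance, \<open>v\<close> becomes the next parent; otherwise \<open>u\<close>
  is a successor of such a world, shares its boxes with its own successors, and so has a witness
  itself. Under 4 without 5, the choice depends on whether the box set grew from \<open>u\<close> to
  \<open>v\<close>.\<close>

lemma tagged_witness:
  assumes n: "n < md \<phi>" and per: "persistent \<alpha>" and par: "parent \<alpha> (base (Suc n)) u"
    and uv: "(u, v) \<in> acc M \<alpha>" and dia: "sat M v (Dia \<alpha> \<chi>)"
    and \<chi>: "Dia \<alpha> \<chi> \<in> sub_bar \<phi> \<or> \<chi> = TT"
  shows "\<exists>u' v'. parent \<alpha> (base (Suc n)) u' \<and> (u', v') \<in> acc M \<alpha> \<and> sat M v' \<chi> \<and>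
    edge \<alpha> (v, n, Some \<alpha>) (v', n, Some \<alpha>)"
proof (cases "c5 \<in> L \<alpha>")
  case True
  note near_range = near_mono[OF _ base_le]
  have uR: "u \<in> range_M" and vR: "v \<in> range_M"
    using parent_near[OF per n par uv, THEN near_range] by auto
  have edgeI: "edge \<alpha> (v, n, Some \<alpha>) (v', n, Some \<alpha>)"
    if "boxes \<alpha> v' = boxes \<alpha> v" "\<forall>\<psi>\<in>boxes \<alpha> v. sat M v' \<psi>" for v'
  proof -
    \<comment> \<open>For the B clause of \<open>edge\<close>: the boxes of \<open>v'\<close> are
      those of \<open>v\<close>, which hold at \<open>u\<close>, so their bodies hold at
      \<open>v\<close>.\<close>
    have "boxes \<alpha> v \<subseteq> boxes \<alpha> u" using boxes_antimono_5 uR True uv by blast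
    then have "\<forall>\<psi>\<in>boxes \<alpha> v. sat M v \<psi>" using boxesD uv by blast
    then show ?thesis using that True by (auto simp: edge_def profile_def)
  qed
  consider "u \<in> near M w (base (Suc n))" |
    u0 where "u0 \<in> near M w (base (Suc n))" "(u0, u) \<in> acc M \<alpha>"
    using par True by (auto simp: parent_def)
  then show ?thesis
  proof cases
    case 1
    then have par': "parent \<alpha> (base (Suc n)) v"
      using uv True by (auto simp: parent_def)
    obtain v' where v': "(v, v') \<in> acc M \<alpha>" "sat M v' \<chi>"
      using dia by auto
    have "v' \<in> range_M"
      using near_range[OF parent_near(2)[OF per n par' v'(1)]] .
    then have "boxes \<alpha> v' = boxes \<alpha> v"
      using boxes_eq_5_grandchild uR vR True uv v'(1) by blast
    then have "edge \<alpha> (v, n, Some \<alpha>) (v', n, Some \<alpha>)"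
      using edgeI boxesD v'(1) by blast
    then show ?thesis using par' v' by blast
  next
    case 2
    have u0R: "u0 \<in> range_M" using near_range[OF 2(1)] .
    have eq: "boxes \<alpha> z = boxes \<alpha> u" if "(u, z) \<in> acc M \<alpha>" for z
      using boxes_eq_5_grandchild[OF u0R uR _ True 2(2) that]
        near_range[OF parent_near(2)[OF per n par that]] by blast
    then have "sat M u (Dia \<alpha> \<chi>)"
      using boxes_eq_sat_Dia[of \<alpha> u v \<chi>] uv dia \<chi> by simp
    then obtain v' where v': "(u, v') \<in> acc M \<alpha>" "sat M v' \<chi>"
      by auto
    have "edge \<alpha> (v, n, Some \<alpha>) (v', n, Some \<alpha>)"
      using edgeI[of v'] eq[OF v'(1)] eq[OF uv] boxesD[of _ \<alpha> u v'] v'(1) by blast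
    then show ?thesis using par v' by blast
  qed
next
  case False
  then have c4: "c4 \<in> L \<alpha>" using per by (simp add: persistent_def)
  note near_range = near_mono[OF _ base_le]
  have uR: "u \<in> range_M" and vR: "v \<in> range_M"
    using parent_near[OF per n par uv, THEN near_range] by auto
  have uv_mono: "boxes \<alpha> u \<subseteq> boxes \<alpha> v" using boxes_mono_4 uR c4 uv by blast
  show ?thesis
  proof (cases "boxes \<alpha> u = boxes \<alpha> v")
    case True
    then have "sat M u (Dia \<alpha> \<chi>)"
      using boxes_eq_sat_Dia[of \<alpha> u v \<chi>] uv dia \<chi> by simp
    then obtain v' where v': "(u, v') \<in> acc M \<alpha>" "sat M v' \<chi>"
      by auto
    have "v' \<in> range_M"
      using near_range[OF parent_near(2)[OF per n par v'(1)]] .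
    \<comment> \<open>Here \<open>v\<close> and \<open>v'\<close> are siblings. All comparisons go
      through the box set of \<open>u\<close>, which equals that of \<open>v\<close>.\<close>
    have "edge \<alpha> (v, n, Some \<alpha>) (v', n, Some \<alpha>)"
      unfolding edge_def
      using False c4 boxesD[of _ \<alpha> u v'] boxesD[of _ \<alpha> u v] boxes_mono_4[of u \<alpha> v']
        boxes_antimono_4B[of u v' \<alpha>] True v'(1) uv uR \<open>v' \<in> range_M\<close> by auto
    then show ?thesis using par v' by blast
  next
    case neq: False
    then have "card (boxes \<alpha> u) < card (boxes \<alpha> v)"
      using uv_mono finite_boxes by (intro psubset_card_mono) auto
    moreover have "v \<in> near M w (Suc (base (Suc n) + card (boxes \<alpha> u)))"
      using par False uv near_step by (auto simp: parent_def)
    ultimately have "v \<in> near M w (base (Suc n) + card (boxes \<alpha> v))"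
      using near_mono by (metis Suc_leI add_Suc_right nat_add_left_cancel_le)
    then have par': "parent \<alpha> (base (Suc n)) v"
      using False by (simp add: parent_def)
    obtain v' where v': "(v, v') \<in> acc M \<alpha>" "sat M v' \<chi>"
      using dia by auto
    have "v' \<in> range_M"
      using near_range[OF parent_near(2)[OF per n par' v'(1)]] .
    then have "edge \<alpha> (v, n, Some \<alpha>) (v', n, Some \<alpha>)"
      using edge_from_entry[of v v' \<alpha>] vR v'(1) False per by simp
    then show ?thesis using par' v' by blast
  qed
qed

text \<open>A tagged node moves inside its cluster and keeps its rank. An untagged one follows a
  real step of \<open>M\<close> and gives up one unit of rank, which pays for that step.\<close>

lemma step_witness:
  assumes s: "s \<in> nodes" and lev: "level \<alpha> s > 0" and dia: "sat M (world s) (Dia \<alpha> \<chi>)"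
    and \<chi>: "Dia \<alpha> \<chi> \<in> sub_bar \<phi> \<or> \<chi> = TT"
  shows "\<exists>t\<in>nodes. step \<alpha> s t \<and> sat M (world t) \<chi>"
proof (cases "tag s = Some \<alpha>")
  case True
  then obtain v n where sn: "s = (v, n, Some \<alpha>)"
    by (metis prod.collapse)
  then obtain u where u: "n < md \<phi>" "persistent \<alpha>" "parent \<alpha> (base (Suc n)) u" "(u, v) \<in> acc M \<alpha>"
    using s by (auto simp: nodes_def)
  then obtain u' v' where "parent \<alpha> (base (Suc n)) u'" "(u', v') \<in> acc M \<alpha>" "sat M v' \<chi>"
    "edge \<alpha> (v, n, Some \<alpha>) (v', n, Some \<alpha>)"
    using tagged_witness[of n \<alpha> u v \<chi>] dia \<chi> sn by auto
  then show ?thesis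
    using u sn
    by (intro bexI[of _ "(v', n, Some \<alpha>)"]) (auto simp: nodes_def step_def adjacent_def level_def)
next
  case False
  obtain u n a where sn: "s = (u, n, a)"
    by (metis prod.collapse)
  have n: "n > 0" using lev False sn by (simp add: level_def)
  then obtain m where m: "n = Suc m" by (cases n) auto
  have "n \<le> md \<phi>" using s sn by (auto simp: nodes_def)
  then have m_less: "m < md \<phi>" using m by simp
  have u: "u \<in> near M w (base (Suc m))" using node_near[OF s] sn m by simp
  obtain v where v: "(u, v) \<in> acc M \<alpha>" "sat M v \<chi>"
    using dia sn by auto
  have "Suc (base (Suc m)) \<le> base m"
    using base_Suc[OF m_less] c_pos by linarith
  then have v_near: "v \<in> near M w (base m)"
    using near_mono[OF near_step[OF u v(1)]] by blast
  define t where "t = (v, m, if persistent \<alpha> then Some \<alpha> else None)"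
  have "t \<in> nodes"
    using v_near m_less v(1) parent_of_near[OF u] by (auto simp: t_def nodes_def)
  moreover have "edge \<alpha> s t"
    using edge_from_entry[of u v \<alpha> s t] near_mono[OF u base_le] near_mono[OF v_near base_le]
      v(1) sn False by (simp add: t_def)
  moreover have "adjacent \<alpha> s t"
    using False sn m by (auto simp: adjacent_def level_def t_def)
  ultimately show ?thesis
    using v(2) by (auto simp: step_def t_def)
qed

section \<open>Transfer of truth to the node model\<close>

text \<open>Positive rank excludes the loop at level 0, and a level exceeds the rank by at most
  one.\<close>

lemma step_rank:
  assumes "step \<alpha> s t" "rank s > 0"
  shows "rank s \<le> Suc (rank t)" "\<psi> \<in> boxes \<alpha> (world s) \<Longrightarrow> sat M (world t) \<psi>"
proof -
  have lev: "rank s \<le> level \<alpha> s" "level \<alpha> t \<le> Suc (rank t)" by (auto simp: level_def)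
  then have *: "adjacent \<alpha> s t" "edge \<alpha> s t"
    using assms by (auto simp: step_def)
  then show "rank s \<le> Suc (rank t)"
    using lev by (auto simp: adjacent_def split: if_splits)
  show "\<psi> \<in> boxes \<alpha> (world s) \<Longrightarrow> sat M (world t) \<psi>"
    using * by (simp add: edge_def)
qed

text \<open>Formulas are in negation normal form, so truth can be transferred without falsity. The
  rank bounds the modal depth still to be evaluated.\<close>

lemma sat_node_model:
  "s \<in> nodes \<Longrightarrow> \<psi> \<in> sub \<phi> \<Longrightarrow> md \<psi> \<le> rank s \<Longrightarrow> sat M (world s) \<psi> \<Longrightarrow> sat node_model s \<psi>"
proof (induction \<psi> arbitrary: s)
  case (Prop p)
  then show ?case by (simp add: node_model_def)
next
  case (NProp p)
  then show ?case by (simp add: node_model_def)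
next
  case (And \<psi>1 \<psi>2)
  have "\<psi>1 \<in> sub \<phi>" "\<psi>2 \<in> sub \<phi>"
    using sub_trans[OF And.prems(2)] sub_self[of \<psi>1] sub_self[of \<psi>2] by auto
  then show ?case
    using And.prems And.IH(1)[of s] And.IH(2)[of s] by auto
next
  case (Or \<psi>1 \<psi>2)
  have "\<psi>1 \<in> sub \<phi>" "\<psi>2 \<in> sub \<phi>"
    using sub_trans[OF Or.prems(2)] sub_self[of \<psi>1] sub_self[of \<psi>2] by auto
  then show ?case
    using Or.prems Or.IH(1)[of s] Or.IH(2)[of s] by auto
next
  case (Dia \<alpha> \<psi>)
  have "\<psi> \<in> sub \<phi>" using sub_trans[OF Dia.prems(2)] sub_self[of \<psi>] by auto
  have "rank s > 0" using Dia.prems by simp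
  then have "level \<alpha> s > 0" by (simp add: level_def)
  then obtain t where t: "t \<in> nodes" "step \<alpha> s t" "sat M (world t) \<psi>"
    using step_witness[OF Dia.prems(1) _ Dia.prems(4)] Dia.prems(2) by (auto simp: sub_bar_def)
  have "md \<psi> \<le> rank t"
    using step_rank(1)[OF t(2) \<open>rank s > 0\<close>] Dia.prems(3) by simp
  then have "sat node_model t \<psi>"
    using Dia.IH t \<open>\<psi> \<in> sub \<phi>\<close> by blast
  then show ?case
    using t Dia.prems(1) unfolding sat.simps(7) acc_node_model by blast
next
  case (Box \<alpha> \<psi>)
  have "\<psi> \<in> sub \<phi>" using sub_trans[OF Box.prems(2)] sub_self[of \<psi>] by auto
  have "rank s > 0" using Box.prems by simp
  have "sat node_model t \<psi>" if "t \<in> nodes" "step \<alpha> s t" for t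
  proof (rule Box.IH)
    show "md \<psi> \<le> rank t"
      using step_rank(1)[OF that(2) \<open>rank s > 0\<close>] Box.prems(3) by simp
    have "\<psi> \<in> boxes \<alpha> (world s)"
      using Box.prems(2,4) by (simp add: boxes_def sub_bar_def)
    then show "sat M (world t) \<psi>"
      using step_rank(2)[OF that(2) \<open>rank s > 0\<close>] by blast
  qed (use that \<open>\<psi> \<in> sub \<phi>\<close> in auto)
  then show ?case
    by (simp add: acc_node_model)
qed simp_all

section \<open>Frame conditions of the node model\<close>

lemma profile_subset_boxes:
  assumes "s \<in> nodes" "c5 \<in> L \<alpha>"
  shows "profile \<alpha> s \<subseteq> boxes \<alpha> (world s)"
proof
  fix \<psi> assume "\<psi> \<in> profile \<alpha> s"
  then consider "\<psi> \<in> boxes \<alpha> (world s)" |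
    v where "Box \<alpha> \<psi> \<in> sub_bar \<phi>" "(world s, v) \<in> acc M \<alpha>" "sat M v (Box \<alpha> \<psi>)"
    unfolding profile_def sat.simps(7) by (auto split: if_splits simp del: sat.simps)
  then show "\<psi> \<in> boxes \<alpha> (world s)"
  proof cases
    case 2
    then show ?thesis
      using axiom_5[OF node_range[OF assms(1)] assms(2) sub_bar_bodyD[OF 2(1)]]
      unfolding boxes_def by blast
  qed
qed

lemma step_serial:
  assumes "cD \<in> L \<alpha>" "s \<in> nodes"
  shows "\<exists>t\<in>nodes. step \<alpha> s t"
proof (cases "level \<alpha> s = 0")
  case True
  then show ?thesis using assms by (auto simp: step_def)
next
  case False
  have "sat M (world s) (Dia \<alpha> TT)"
    using axiom_D[OF node_range[OF assms(2)] assms(1)] by simp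
  then show ?thesis
    using step_witness[of s \<alpha> TT] assms False by blast
qed

lemma step_refl:
  assumes "cT \<in> L \<alpha>" "s \<in> nodes"
  shows "step \<alpha> s s"
  using sat_boxes_T[OF node_range[OF assms(2)] assms(1)] assms(1)
  by (auto simp: step_def adjacent_def edge_def euc_only_def)

lemma step_sym:
  assumes "cB \<in> L \<alpha>" "step \<alpha> s t"
  shows "step \<alpha> t s"
  using assms by (auto simp: step_def adjacent_def edge_def euc_only_def split: if_splits)

lemma step_trans:
  assumes "c4 \<in> L \<alpha>" "step \<alpha> s t" "step \<alpha> t t'"
  shows "step \<alpha> s t'"
proof -
  have "persistent \<alpha>" "\<not> euc_only \<alpha>" using assms(1) by (auto simp: persistent_def euc_only_def)
  then show ?thesis
    using assms by (auto simp: step_def adjacent_def edge_def profile_def split: if_splits)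
qed

text \<open>The box sets of \<open>t\<close> and \<open>t'\<close> both equal the profile of
  \<open>s\<close>. By axiom 5 these boxes hold at \<open>s\<close>, so their bodies hold at both
  targets, as an edge between them demands.\<close>

lemma step_euclidean:
  assumes "c5 \<in> L \<alpha>" "step \<alpha> s t" "step \<alpha> s t'" "s \<in> nodes"
  shows "step \<alpha> t t'"
proof (cases "level \<alpha> s = 0")
  case True
  have "persistent \<alpha>" using assms(1) by (simp add: persistent_def)
  then show ?thesis using assms True by (auto simp: step_def adjacent_def)
next
  case False
  have per: "persistent \<alpha>" using assms(1) by (simp add: persistent_def)
  have st: "adjacent \<alpha> s t" "edge \<alpha> s t" "adjacent \<alpha> s t'" "edge \<alpha> s t'"
    using assms False by (auto simp: step_def)
  have eq: "profile \<alpha> s = profile \<alpha> t" "profile \<alpha> s = profile \<alpha> t'"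
    using st assms(1) by (auto simp: edge_def)
  have tag: "euc_only \<alpha> \<longrightarrow> tag t = Some \<alpha> \<and> tag t' = Some \<alpha>"
    using st assms(1) by (auto simp: edge_def)
  have bx: "boxes \<alpha> (world t) = profile \<alpha> s" "boxes \<alpha> (world t') = profile \<alpha> s"
    using eq tag by (auto simp: profile_def)
  have "\<forall>\<psi>\<in>profile \<alpha> s. sat M (world t) \<psi> \<and> sat M (world t') \<psi>"
    using profile_subset_boxes[OF assms(4,1)] st by (auto simp: edge_def)
  then have "edge \<alpha> t t'"
    using assms(1) eq tag by (auto simp: edge_def bx)
  moreover have "adjacent \<alpha> t t'"
    using st per by (auto simp: adjacent_def)
  ultimately show ?thesis by (simp add: step_def)
qed

lemma root_in_nodes: "(w, md \<phi>, None) \<in> nodes"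
  by (simp add: nodes_def)

lemma root_in_worlds: "(w, md \<phi>, None) \<in> worlds node_model"
  using root_in_nodes by (simp add: node_model_def)

lemma L_model_node_model: "L_model L node_model"
proof -
  have worlds: "worlds node_model = nodes" by (simp add: node_model_def)
  have "kripke_model node_model"
    using root_in_nodes by (auto simp: kripke_model_def node_model_def)
  moreover have "satisfies_cond nodes (acc node_model \<alpha>) y" if y: "y \<in> L \<alpha>" for \<alpha> y
  proof (cases y)
    case cD
    then show ?thesis
      using step_serial y by (auto simp: serial_on_def acc_node_model)
  next
    case cT
    then show ?thesis
      using step_refl y by (auto simp: refl_on_def acc_node_model)
  next
    case cB
    then show ?thesis
      using step_sym y by (auto simp: sym_def acc_node_model)
  next
    case c4
    then show ?thesis
      using step_trans[of \<alpha>] y by (auto simp: acc_node_model intro!: transI)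
  next
    case c5
    then show ?thesis
      using step_euclidean[of \<alpha>] y unfolding c5 satisfies_cond.simps euclidean_def acc_node_model
      by blast
  qed
  ultimately show ?thesis
    by (simp add: L_model_def worlds)
qed

lemma sat_root: "sat node_model (w, md \<phi>, None) \<phi>"
  using sat_node_model[OF root_in_nodes] sat_\<phi> by simp

end

section \<open>Both directions of the reduction\<close>

theorem theorem3p6:
  fixes A :: "'ag::finite set"
    and x :: cond
    and L1 L2 :: "'ag \<Rightarrow> cond set"
    and \<phi> :: "('ag, 'p::finite) fm"
  assumes "\<And>\<alpha>. \<alpha> \<in> A \<Longrightarrow> L1 \<alpha> = L2 \<alpha> \<union> {x}"
    and "\<And>\<alpha>. \<alpha> \<notin> A \<Longrightarrow> L1 \<alpha> = L2 \<alpha>"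
    and "\<And>\<alpha> y. y \<in> L2 \<alpha> \<Longrightarrow> precedes y x"
  shows "satisfiable TYPE('w::infinite) L1 \<phi> \<longleftrightarrow> satisfiable TYPE('w) L2 (tr x A \<phi>)"
proof
  assume "satisfiable TYPE('w) L1 \<phi>"
  then obtain M :: "('w, 'ag, 'p) kripke" and w
    where M: "L_model L1 M" "w \<in> worlds M" "sat M w \<phi>"
    by (auto simp: satisfiable_def)
  have "L2 \<alpha> \<subseteq> L1 \<alpha>" for \<alpha>
    using assms(1,2) by (cases "\<alpha> \<in> A") auto
  then have "L_model L2 M"
    using M(1) by (auto simp: L_model_def)
  moreover have "sat M w (tr x A \<phi>)"
    using M assms(1) near_worlds[OF _ M(2)]
    by (auto simp: sat_tr L_model_def intro!: sat_ax_inst_of_cond)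
  ultimately show "satisfiable TYPE('w) L2 (tr x A \<phi>)"
    using M(2) unfolding satisfiable_def by blast
next
  assume "satisfiable TYPE('w) L2 (tr x A \<phi>)"
  then obtain M :: "('w, 'ag, 'p) kripke" and w
    where M: "L_model L2 M" "w \<in> worlds M" "sat M w (tr x A \<phi>)"
    by (auto simp: satisfiable_def)
  define c where "c = (if x \<in> {c4, c5} then fm_size \<phi> else 1)"
  have depth: "tr_depth x \<phi> = md \<phi> * c"
    by (simp add: tr_depth_def c_def)
  have nearby: "axioms_nearby M w \<phi> L1 c"
  proof
    show "sat M w \<phi>" using M(3) by (simp add: sat_tr)
    show "c \<ge> 1" using fm_size_pos[of \<phi>] by (simp add: c_def)
  next
    fix v y \<alpha> \<psi>
    assume v: "v \<in> near M w (md \<phi> * c)" and y: "y \<in> L1 \<alpha>" and \<psi>: "\<psi> \<in> sub_bar \<phi>"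
    have "v \<in> worlds M"
      using near_worlds M(1,2) v by (auto simp: L_model_def)
    \<comment> \<open>Axioms of \<open>L2\<close> hold because of the frame, those of
      \<open>x\<close> because of the translation, up to its depth.\<close>
    moreover have "y \<in> L2 \<alpha> \<or> y = x \<and> \<alpha> \<in> A"
      using y assms(1,2) by (cases "\<alpha> \<in> A") auto
    ultimately show "sat M v (ax_inst y \<alpha> \<psi>)"
      using M(1,3) v \<psi> sat_ax_inst_of_cond[of v M \<alpha> y \<psi>]
      by (auto simp: L_model_def sat_tr depth)
  next
    fix \<alpha> assume "c4 \<in> L1 \<alpha> \<or> c5 \<in> L1 \<alpha>"
    then have "c4 \<in> L2 \<alpha> \<or> c5 \<in> L2 \<alpha> \<or> x \<in> {c4, c5}"
      using assms(1,2) by (cases "\<alpha> \<in> A") auto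
    \<comment> \<open>The order enters here: a 4 in \<open>L2\<close> precedes \<open>x\<close> and
      forces \<open>x\<close> to be 5, and 5 precedes nothing.\<close>
    then have "x \<in> {c4, c5}"
      using assms(3)[of c4 \<alpha>] assms(3)[of c5 \<alpha>] by (cases x) (auto simp: precedes_def)
    then show "c = fm_size \<phi>" by (simp add: c_def)
  qed
  show "satisfiable TYPE('w) L1 \<phi>"
    by (rule satisfiable_of_model[OF axioms_nearby.L_model_node_model[OF nearby]
          axioms_nearby.root_in_worlds[OF nearby] axioms_nearby.sat_root[OF nearby]])
qed

end
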